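(* Let $s,t$ be positive integers, let $n_{1}\geq n_{2}\geq \cdots\geq n_s$ and $m_1\geq m_2\geq \cdots\geq m_t$ be odd positive integers, and let $F_1=\bigsqcup_{i=1}^{s}K_{1,n_i}$ and $F_2=\bigsqcup_{j=1}^{t}K_{1,m_j}$. Then $$\hat{r}(F_1,F_2)= \sum_{k=2}^{s+t}l_k,$$ where, for $2\leq k\leq s+t$, $l_k=\max\{n_i+m_j-1 : 1\leq i\leq s,\ 1\leq j\leq t,\ i+j=k\}$.
   Context: All graphs are undirected, simple, finite and without isolated vertices. $K_{1,n}$ is the star with one root vertex joined to $n$ leaves. $\sqcup$ denotes disjoint union of graphs. For graphs $F_1,F_2,G$, write $G\rightarrow(F_1,F_2)$ if for every coloring of the edges of $G$ by red and blue there is either a red copy of $F_1$ or a blue copy of $F_2$ in $G$ (copies are subgraphs, not necessarily induced). The size Ramsey number $\hat{r}(F_1,F_2)$ is the minimum number of edges of a graph $G$ such that $G\rightarrow(F_1,F_2)$. *)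

theory Defs
  imports Main
begin

record 'a graph =
  verts :: "'a set"
  edges :: "'a set set"

definition simple_graph :: "'a graph \<Rightarrow> bool" where
  "simple_graph G \<longleftrightarrow>
     finite (verts G) \<and>
     (\<forall>e\<in>edges G. e \<subseteq> verts G \<and> card e = 2) \<and>
     (\<forall>v\<in>verts G. \<exists>e\<in>edges G. v \<in> e)"

definition star :: "nat \<Rightarrow> nat graph" where
  "star n = \<lparr>verts = {0..n}, edges = {{0, i} | i. i \<in> {1..n}}\<rparr>"

definition disjoint_union :: "'i set \<Rightarrow> ('i \<Rightarrow> 'a graph) \<Rightarrow> ('i \<times> 'a) graph" where
  "disjoint_union I H =
     \<lparr>verts = (SIGMA i:I. verts (H i)),
      edges = {Pair i ` e | i e. i \<in> I \<and> e \<in> edges (H i)}\<rparr>"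

text \<open>Copies are subgraphs, not necessarily induced: non-edges may be mapped to edges.\<close>

definition contains_copy :: "'a graph \<Rightarrow> 'b graph \<Rightarrow> bool" where
  "contains_copy G F \<longleftrightarrow>
     (\<exists>f. inj_on f (verts F) \<and> f ` verts F \<subseteq> verts G \<and> (\<forall>e\<in>edges F. f ` e \<in> edges G))"

datatype colour = Red | Blue

definition colour_subgraph :: "'a graph \<Rightarrow> ('a set \<Rightarrow> colour) \<Rightarrow> colour \<Rightarrow> 'a graph" where
  "colour_subgraph G c x = \<lparr>verts = verts G, edges = {e \<in> edges G. c e = x}\<rparr>"

definition arrows :: "'a graph \<Rightarrow> 'b graph \<Rightarrow> 'c graph \<Rightarrow> bool" where
  "arrows G F1 F2 \<longleftrightarrow>
     (\<forall>c. contains_copy (colour_subgraph G c Red) F1 \<or>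
          contains_copy (colour_subgraph G c Blue) F2)"

text \<open>
  Host graphs may be taken on natural numbers, as every finite graph is isomorphic to one of
  these (see \<open>arrows_nat_host\<close> below). The infimum is over a set of natural numbers, hence a
  minimum whenever that set is nonempty; for the empty set it is \<open>0\<close>.
\<close>

definition size_ramsey :: "'a graph \<Rightarrow> 'b graph \<Rightarrow> nat" where
  "size_ramsey F1 F2 =
     Inf {card (edges G) | G :: nat graph. simple_graph G \<and> arrows G F1 F2}"

lemma simple_graph_star:
  assumes "n \<ge> 1"
  shows "simple_graph (star n)"
proof -
  have "\<exists>e\<in>edges (star n). v \<in> e" if "v \<in> verts (star n)" for v
  proof (cases "v = 0")
    case True
    then have "{0, 1} \<in> edges (star n)" "v \<in> {0, 1}" using assms by (auto simp: star_def)
    then show ?thesis by blast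
  next
    case False
    then have "{0, v} \<in> edges (star n)" "v \<in> {0, v}" using that by (auto simp: star_def)
    then show ?thesis by blast
  qed
  moreover have "finite (verts (star n))"
    by (simp add: star_def)
  moreover have "e \<subseteq> verts (star n) \<and> card e = 2" if "e \<in> edges (star n)" for e
    using that by (auto simp: star_def)
  ultimately show ?thesis unfolding simple_graph_def by blast
qed

lemma simple_graph_disjoint_union:
  assumes "finite I" "\<And>i. i \<in> I \<Longrightarrow> simple_graph (H i)"
  shows "simple_graph (disjoint_union I H)"
  unfolding simple_graph_def
proof (intro conjI ballI)
  show "finite (verts (disjoint_union I H))"
    using assms by (auto simp: disjoint_union_def simple_graph_def)
next
  fix e assume "e \<in> edges (disjoint_union I H)"
  then obtain i e' where e: "i \<in> I" "e' \<in> edges (H i)" "e = Pair i ` e'"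
    by (auto simp: disjoint_union_def)
  have e': "e' \<subseteq> verts (H i)" "card e' = 2"
    using assms(2)[OF e(1)] e(2) by (auto simp: simple_graph_def)
  show "e \<subseteq> verts (disjoint_union I H)"
    using e e' by (auto simp: disjoint_union_def)
  show "card e = 2"
    using e e' by (simp add: card_image inj_on_def)
next
  fix v assume "v \<in> verts (disjoint_union I H)"
  then obtain i w where v: "v = (i, w)" "i \<in> I" "w \<in> verts (H i)"
    by (auto simp: disjoint_union_def)
  then obtain e where e: "e \<in> edges (H i)" "w \<in> e"
    using assms(2)[OF v(2)] unfolding simple_graph_def by blast
  then have "Pair i ` e \<in> edges (disjoint_union I H)" "v \<in> Pair i ` e"
    using v by (auto simp: disjoint_union_def)
  then show "\<exists>e\<in>edges (disjoint_union I H). v \<in> e" by blast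
qed

lemma arrows_nat_host:
  fixes G :: "'a graph"
  assumes G: "simple_graph G" and arr: "arrows G F1 F2"
  shows "\<exists>G' :: nat graph. simple_graph G' \<and> card (edges G') = card (edges G) \<and> arrows G' F1 F2"
proof -
  obtain g :: "'a \<Rightarrow> nat" where g: "inj_on g (verts G)"
    using G finite_imp_inj_to_nat_seg[of "verts G"] by (auto simp: simple_graph_def)
  define G' where "G' = \<lparr>verts = g ` verts G, edges = (`) g ` edges G\<rparr>"
  have sub: "e \<subseteq> verts G" if "e \<in> edges G" for e
    using G that by (auto simp: simple_graph_def)
  have card2: "card (g ` e) = 2" if "e \<in> edges G" for e
    using G that card_image[OF inj_on_subset[OF g sub[OF that]]] by (auto simp: simple_graph_def)
  have inc: "\<exists>e\<in>edges G. v \<in> e" if "v \<in> verts G" for v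
    using G that by (auto simp: simple_graph_def)
  have s: "simple_graph G'"
    unfolding simple_graph_def
  proof (intro conjI ballI)
    show "finite (verts G')" using G by (simp add: G'_def simple_graph_def)
  next
    fix e assume "e \<in> edges G'"
    then obtain e' where e': "e' \<in> edges G" "e = g ` e'" by (auto simp: G'_def)
    show "e \<subseteq> verts G'" using sub[OF e'(1)] e'(2) by (auto simp: G'_def)
    show "card e = 2" using card2[OF e'(1)] e'(2) by simp
  next
    fix v assume "v \<in> verts G'"
    then obtain w where "w \<in> verts G" "v = g w" by (auto simp: G'_def)
    then obtain e where "e \<in> edges G" "w \<in> e" using inc by blast
    with \<open>v = g w\<close> have "g ` e \<in> edges G'" "v \<in> g ` e" by (auto simp: G'_def)
    then show "\<exists>e\<in>edges G'. v \<in> e" by blast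
  qed
  have "inj_on ((`) g) (edges G)"
    using sub by (auto intro!: inj_onI simp: inj_on_image_eq_iff[OF g])
  then have c: "card (edges G') = card (edges G)"
    by (simp add: G'_def card_image)
  have push: "contains_copy (colour_subgraph G' c x) F"
    if copy: "contains_copy (colour_subgraph G (\<lambda>e. c (g ` e)) x) F"
    for c x and F :: "'z graph"
  proof -
    obtain f where f: "inj_on f (verts F)" "f ` verts F \<subseteq> verts G"
      "\<forall>e\<in>edges F. f ` e \<in> edges G \<and> c (g ` f ` e) = x"
      using copy by (auto simp: contains_copy_def colour_subgraph_def)
    have "inj_on (g \<circ> f) (verts F)"
      by (rule comp_inj_on[OF f(1) inj_on_subset[OF g f(2)]])
    then show ?thesis
      using f(2,3) unfolding contains_copy_def colour_subgraph_def G'_def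
      by (intro exI[of _ "g \<circ> f"]) (auto simp: image_image)
  qed
  have "arrows G' F1 F2"
    unfolding arrows_def
  proof
    fix c
    have "contains_copy (colour_subgraph G (\<lambda>e. c (g ` e)) Red) F1 \<or>
          contains_copy (colour_subgraph G (\<lambda>e. c (g ` e)) Blue) F2"
      using arr by (simp add: arrows_def)
    then show "contains_copy (colour_subgraph G' c Red) F1 \<or>
          contains_copy (colour_subgraph G' c Blue) F2"
      by (elim disjE) (simp_all only: push simp_thms)
  qed
  with s c show ?thesis by blast
qed

end

theory Submission
  imports Defs
begin

text \<open>
  \<^bold>\<open>Lower bound.\<close> Let \<open>G\<close> arrow the pair of star forests and let \<open>i + j = k\<close>. After deleting any
  set \<open>W\<close> of at most \<open>k - 2\<close> vertices, some vertex still has degree at least \<open>n\<^sub>i + m\<^sub>j - 1\<close>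
  (\<open>arrows_imp_large_degree\<close>). If not, split \<open>W\<close> into \<open>A\<close> with fewer than \<open>i\<close> and \<open>B\<close> with
  fewer than \<open>j\<close> vertices, colour every edge at \<open>A\<close> red, every remaining edge at \<open>B\<close> blue, and
  split the rest, which has maximum degree at most \<open>(n\<^sub>i - 1) + (m\<^sub>j - 1)\<close>, into a red graph of
  maximum degree at most \<open>n\<^sub>i - 1\<close> and a blue one of maximum degree at most \<open>m\<^sub>j - 1\<close>. A star
  with at least \<open>n\<^sub>i\<close> red edges must then meet \<open>A\<close>, but \<open>A\<close> has too few vertices to meet each of
  the \<open>i\<close> largest stars of a red copy; likewise in blue. So neither copy exists, a contradiction.
  Choosing \<open>i\<close> and \<open>j\<close> that attain the maximum \<open>l\<^sub>k\<close>, and deleting vertices of degree at least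
  \<open>l\<^sub>2\<close>, \<open>l\<^sub>3\<close> and so on one after another, one finds at least \<open>l\<^sub>2 + l\<^sub>3 + \<dots>\<close> distinct edges
  (\<open>sum_le_card_edges\<close>).

  Oddness is what makes the split possible: \<open>n\<^sub>i - 1 = 2a\<close> and \<open>m\<^sub>j - 1 = 2b\<close> are even, and every
  graph of maximum degree at most \<open>2a + 2b\<close> is the union of edge-disjoint graphs of maximum
  degrees at most \<open>2a\<close> and \<open>2b\<close> (\<open>even_degree_split\<close>, essentially Petersen's 2-factor theorem).
  Orient the graph with in- and outdegrees at most \<open>a + b\<close>, regard the arcs as edges of a
  bipartite graph between two copies of the vertex set, and split that into parts of maximum
  degrees at most \<open>a\<close> and \<open>b\<close>. Both steps are instances of one fact on orientations with bounded in- and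
  outdegrees (\<open>orientation_with_degree_bounds\<close>): a 2-colouring of a bipartite graph is the same as
  an orientation of it, where red edges point from left to right and blue ones from right to left.

  \<^bold>\<open>Upper bound.\<close> The disjoint union of the stars \<open>star (l k)\<close> arrows (\<open>star_forest_arrows\<close>).
  If a colouring has no red copy, then for some \<open>i\<close> fewer than \<open>i\<close> of these stars have at least
  \<open>n\<^sub>i\<close> red edges, since otherwise a copy can be embedded greedily. If it has no blue copy, then for
  some \<open>j\<close> fewer than \<open>j\<close> of them have at least \<open>m\<^sub>j\<close> blue edges. So among the \<open>i + j - 1\<close> stars with
  \<open>2 \<le> k \<le> i + j\<close> there is one with at most \<open>n\<^sub>i + m\<^sub>j - 2\<close> edges, although \<open>l\<^sub>k \<ge> n\<^sub>i + m\<^sub>j - 1\<close>.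
\<close>

section \<open>Orientations with prescribed degree bounds\<close>

text \<open>
  A directed graph is its set of arcs. Indegrees in \<open>D\<close> are written \<open>outdeg (D\<inverse>)\<close>; for a symmetric
  relation \<open>outdeg\<close> is the degree of the underlying undirected graph.
\<close>

definition outdeg :: "('a \<times> 'a) set \<Rightarrow> 'a \<Rightarrow> nat" where
  "outdeg D x = card (D `` {x})"

text \<open>
  An undirected graph is a symmetric irreflexive relation \<open>E\<close>; an orientation \<open>D\<close> of it keeps
  exactly one of the pairs \<open>(x, y)\<close>, \<open>(y, x)\<close> of each edge. That \<open>E\<close> is symmetric and irreflexive
  follows from the existence of an orientation and is never assumed separately.
\<close>

definition orientation :: "('a \<times> 'a) set \<Rightarrow> ('a \<times> 'a) set \<Rightarrow> bool" where
  "orientation E D \<longleftrightarrow> D \<union> D\<inverse> = E \<and> D \<inter> D\<inverse> = {}"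

lemma orientation_converse: "orientation E D \<Longrightarrow> orientation E (D\<inverse>)"
  by (auto simp: orientation_def)

lemma outdeg_Un_disjoint:
  assumes "finite A" "finite B" "A \<inter> B = {}"
  shows "outdeg (A \<union> B) x = outdeg A x + outdeg B x"
proof -
  have "(A \<union> B) `` {x} = A `` {x} \<union> B `` {x}" "A `` {x} \<inter> B `` {x} = {}"
    using assms(3) by auto
  then show ?thesis
    using assms(1,2) by (simp add: outdeg_def card_Un_disjoint finite_Image)
qed

lemma outdeg_insert:
  assumes "finite D" "(a, b) \<notin> D"
  shows "outdeg (insert (a, b) D) x = outdeg D x + of_bool (x = a)"
proof -
  have "outdeg {(a, b)} x = of_bool (x = a)"
    by (auto simp: outdeg_def Image_def)
  then show ?thesis
    using outdeg_Un_disjoint[of D "{(a, b)}" x] assms by simp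
qed

lemma outdeg_mono: "finite B \<Longrightarrow> A \<subseteq> B \<Longrightarrow> outdeg A x \<le> outdeg B x"
  unfolding outdeg_def by (intro card_mono finite_Image Image_mono) auto

lemma sum_outdeg:
  assumes "finite D" "finite X" "Domain D \<subseteq> X"
  shows "(\<Sum>x\<in>X. outdeg D x) = card D"
proof -
  have "D = Sigma X (\<lambda>x. D `` {x})"
    using assms(3) by auto
  then have "card D = card (Sigma X (\<lambda>x. D `` {x}))"
    by simp
  also have "\<dots> = (\<Sum>x\<in>X. outdeg D x)"
    unfolding outdeg_def using assms by (intro card_SigmaI) (auto intro: finite_Image)
  finally show ?thesis by simp
qed

lemma orientation_finite: "orientation E D \<Longrightarrow> finite E \<Longrightarrow> finite D"
  by (auto simp: orientation_def)

lemma outdeg_orientation: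
  assumes "orientation E D" "finite E"
  shows "outdeg E x = outdeg D x + outdeg (D\<inverse>) x"
  using outdeg_Un_disjoint[of D "D\<inverse>" x] assms orientation_finite[OF assms]
  by (simp add: orientation_def)

lemma card_orientation_restrict:
  assumes "orientation E D" "finite E"
  shows "card (E \<inter> X \<times> X) = 2 * card (D \<inter> X \<times> X)"
proof -
  have "E \<inter> X \<times> X = (D \<inter> X \<times> X) \<union> (D \<inter> X \<times> X)\<inverse>" "(D \<inter> X \<times> X) \<inter> (D \<inter> X \<times> X)\<inverse> = {}"
    using assms(1) by (auto simp: orientation_def)
  then show ?thesis
    using orientation_finite[OF assms] by (simp add: card_Un_disjoint)
qed

text \<open>A walk can be taken never to return to its starting point.\<close>

lemma rtrancl_first_step:
  assumes "(v, w) \<in> D\<^sup>*" "v \<noteq> w"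
  shows "\<exists>u. (v, u) \<in> D \<and> (u, w) \<in> {(x, y) \<in> D. x \<noteq> v \<and> y \<noteq> v}\<^sup>*"
  using assms
proof (induction rule: rtrancl_induct)
  case base
  then show ?case by simp
next
  case (step y z)
  show ?case
  proof (cases "y = v")
    case True
    then show ?thesis using step by blast
  next
    case False
    then obtain u where u: "(v, u) \<in> D" "(u, y) \<in> {(x, y) \<in> D. x \<noteq> v \<and> y \<noteq> v}\<^sup>*"
      using step by blast
    moreover have "(y, z) \<in> {(x, y) \<in> D. x \<noteq> v \<and> y \<noteq> v}"
      using step False by auto
    ultimately show ?thesis by (meson rtrancl.rtrancl_into_rtrancl)
  qed
qed

text \<open>
  The set \<open>P\<close> of arcs of a simple path from \<open>v\<close> to \<open>w\<close>, recorded only through the balance of its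
  degrees: this is all that is needed to compute the degrees after reversing the path.
\<close>

lemma path_edge_set:
  assumes "finite D" "(v, w) \<in> D\<^sup>*"
  shows "\<exists>P\<subseteq>D. \<forall>x. outdeg P x + of_bool (x = w) = outdeg (P\<inverse>) x + of_bool (x = v)"
  using assms
proof (induction D arbitrary: v rule: finite_psubset_induct)
  case (psubset D)
  show ?case
  proof (cases "v = w")
    case True
    then show ?thesis by (intro exI[of _ "{}"]) (simp add: outdeg_def)
  next
    case False
    define D0 where "D0 = {(x, y) \<in> D. x \<noteq> v \<and> y \<noteq> v}"
    obtain u where u: "(v, u) \<in> D" "(u, w) \<in> D0\<^sup>*"
      using rtrancl_first_step[OF psubset.prems False] by (auto simp: D0_def)
    have "D0 \<subset> D" using u(1) by (auto simp: D0_def)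
    then obtain P where P: "P \<subseteq> D0"
      "\<And>x. outdeg P x + of_bool (x = w) = outdeg (P\<inverse>) x + of_bool (x = u)"
      using psubset.IH[OF _ u(2)] by blast
    have fin: "finite P"
      using P(1) \<open>D0 \<subset> D\<close> psubset.hyps(1) by (meson finite_subset psubset_imp_subset)
    have new: "(v, u) \<notin> P" "(u, v) \<notin> P\<inverse>"
      using P(1) by (auto simp: D0_def)
    have conv: "(insert (v, u) P)\<inverse> = insert (u, v) (P\<inverse>)" by auto
    have "outdeg (insert (v, u) P) x + of_bool (x = w) =
        outdeg ((insert (v, u) P)\<inverse>) x + of_bool (x = v)" for x
      using P(2)[of x] fin new by (simp add: conv outdeg_insert)
    moreover have "insert (v, u) P \<subseteq> D"
      using u(1) P(1) by (auto simp: D0_def)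
    ultimately show ?thesis by blast
  qed
qed

lemma reverse_path:
  assumes or: "orientation E D" and fin: "finite E" and path: "(v, w) \<in> D\<^sup>*"
  shows "\<exists>D'. orientation E D' \<and>
    (\<forall>x. outdeg D' x + of_bool (x = v) = outdeg D x + of_bool (x = w))"
proof -
  have finD: "finite D" using orientation_finite[OF or fin] .
  obtain P where P: "P \<subseteq> D"
    "\<And>x. outdeg P x + of_bool (x = w) = outdeg (P\<inverse>) x + of_bool (x = v)"
    using path_edge_set[OF finD path] by blast
  define D' where "D' = (D - P) \<union> P\<inverse>"
  have finP: "finite P" using P(1) finD by (rule finite_subset)
  have dis: "D \<inter> D\<inverse> = {}" using or by (simp add: orientation_def)
  have "D' \<union> D'\<inverse> = D \<union> D\<inverse>"
    unfolding D'_def using P(1) by auto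
  moreover have "D' \<inter> D'\<inverse> = {}"
    unfolding D'_def using P(1) dis by auto
  ultimately have "orientation E D'"
    using or by (simp add: orientation_def)
  moreover have "outdeg D' x + of_bool (x = v) = outdeg D x + of_bool (x = w)" for x
  proof -
    have "outdeg D' x = outdeg (D - P) x + outdeg (P\<inverse>) x"
      unfolding D'_def using finD finP dis P(1) by (intro outdeg_Un_disjoint) auto
    moreover have "outdeg D x = outdeg (D - P) x + outdeg P x"
      using outdeg_Un_disjoint[of "D - P" P x] finD finP P(1)
      by (simp add: Un_absorb2 Int_commute Diff_disjoint)
    ultimately show ?thesis using P(2)[of x] by linarith
  qed
  ultimately show ?thesis by blast
qed

text \<open>
  The total amount by which \<open>D\<close> violates the bounds \<open>p\<close> on outdegrees and \<open>q\<close> on indegrees. The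
  differences are truncated, so a vertex that respects a bound contributes \<open>0\<close> to it.
\<close>

definition excess :: "('a \<Rightarrow> nat) \<Rightarrow> ('a \<Rightarrow> nat) \<Rightarrow> ('a \<times> 'a) set \<Rightarrow> ('a \<times> 'a) set \<Rightarrow> nat" where
  "excess p q E D = (\<Sum>x\<in>Domain E. (outdeg D x - p x) + (outdeg (D\<inverse>) x - q x))"

lemma excess_converse: "excess p q E (D\<inverse>) = excess q p E D"
  by (simp add: excess_def add.commute)

text \<open>
  If \<open>v\<close> has too large an outdegree, let \<open>R\<close> be the set of vertices reachable from it. All arcs
  leaving a vertex of \<open>R\<close> stay in \<open>R\<close>, and \<open>R\<close> spans at most \<open>\<Sum>x\<in>R. p x\<close> edges, so some \<open>w\<close> in \<open>R\<close>
  has outdegree below its bound; reversing a path from \<open>v\<close> to \<open>w\<close> improves \<open>v\<close> and harms no vertex.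
\<close>

lemma excess_decrease:
  assumes or: "orientation E D" and fin: "finite E"
    and deg: "\<And>x. outdeg E x \<le> p x + q x"
    and sparse: "\<And>X. finite X \<Longrightarrow> card (E \<inter> X \<times> X) \<le> 2 * (\<Sum>x\<in>X. p x)"
    and v: "outdeg D v > p v"
  shows "\<exists>D'. orientation E D' \<and> excess p q E D' < excess p q E D"
proof -
  have finD: "finite D" using orientation_finite[OF or fin] .
  define R where "R = D\<^sup>* `` {v}"
  have vR: "v \<in> R" by (simp add: R_def)
  have "R \<subseteq> insert v (Range D)"
    unfolding R_def by (auto elim: rtranclE)
  then have finR: "finite R" using finD by (meson finite_Range finite_insert finite_subset)
  have closed: "y \<in> R" if "x \<in> R" "(x, y) \<in> D" for x y
    using that by (auto simp: R_def intro: rtrancl_into_rtrancl)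
  have "outdeg D x = outdeg (D \<inter> R \<times> R) x" if "x \<in> R" for x
    unfolding outdeg_def using closed[OF that] that by (intro arg_cong[of _ _ card]) auto
  then have "(\<Sum>x\<in>R. outdeg D x) = (\<Sum>x\<in>R. outdeg (D \<inter> R \<times> R) x)"
    by simp
  also have "\<dots> = card (D \<inter> R \<times> R)"
    using finD finR by (intro sum_outdeg) auto
  also have "\<dots> \<le> (\<Sum>x\<in>R. p x)"
    using sparse[OF finR] card_orientation_restrict[OF or fin, of R] by simp
  finally have le: "(\<Sum>x\<in>R. outdeg D x) \<le> (\<Sum>x\<in>R. p x)" .
  have "\<exists>w\<in>R. outdeg D w < p w"
  proof (rule ccontr)
    assume "\<not> ?thesis"
    then have "\<forall>x\<in>R. p x \<le> outdeg D x" by (auto simp: not_less)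
    then have "(\<Sum>x\<in>R. p x) < (\<Sum>x\<in>R. outdeg D x)"
      using finR vR v by (intro sum_strict_mono_ex1) auto
    then show False using le by simp
  qed
  then obtain w where w: "w \<in> R" "outdeg D w < p w" by blast
  then obtain D' where D': "orientation E D'"
    "\<And>x. outdeg D' x + of_bool (x = v) = outdeg D x + of_bool (x = w)"
    using reverse_path[OF or fin, of v w] by (auto simp: R_def)
  have vw: "v \<noteq> w" using v w by auto
  have inD: "outdeg E x = outdeg D x + outdeg (D\<inverse>) x" for x
    using outdeg_orientation[OF or fin] .
  have inD': "outdeg E x = outdeg D' x + outdeg (D'\<inverse>) x" for x
    using outdeg_orientation[OF D'(1) fin] .
  have "D `` {v} \<noteq> {}" using v by (auto simp: outdeg_def)
  then have vE: "v \<in> Domain E" using or by (auto simp: orientation_def)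
  have lt: "(outdeg D' v - p v) + (outdeg (D'\<inverse>) v - q v)
      < (outdeg D v - p v) + (outdeg (D\<inverse>) v - q v)"
    using D'(2)[of v] inD[of v] inD'[of v] deg[of v] v vw by simp
  have "(outdeg D' x - p x) + (outdeg (D'\<inverse>) x - q x)
      \<le> (outdeg D x - p x) + (outdeg (D\<inverse>) x - q x)" for x
  proof (cases "x = v")
    case True
    then show ?thesis using lt by simp
  next
    case False
    then show ?thesis
      using D'(2)[of x] inD[of x] inD'[of x] w(2) by (cases "x = w") auto
  qed
  then have "excess p q E D' < excess p q E D"
    unfolding excess_def using fin vE lt by (intro sum_strict_mono_ex1) (auto simp: finite_Domain)
  then show ?thesis using D'(1) by blast
qed

text \<open>
  The factor \<open>2\<close> in the sparsity conditions is due to \<open>E\<close> containing each edge in both directions: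
  every vertex set \<open>X\<close> spans at most \<open>\<Sum>x\<in>X. p x\<close> and at most \<open>\<Sum>x\<in>X. q x\<close> edges. These conditions
  are also necessary.
\<close>

theorem orientation_with_degree_bounds:
  assumes "orientation E D\<^sub>0" and fin: "finite E"
    and deg: "\<And>x. outdeg E x \<le> p x + q x"
    and p: "\<And>X. finite X \<Longrightarrow> card (E \<inter> X \<times> X) \<le> 2 * (\<Sum>x\<in>X. p x)"
    and q: "\<And>X. finite X \<Longrightarrow> card (E \<inter> X \<times> X) \<le> 2 * (\<Sum>x\<in>X. q x)"
  shows "\<exists>D. orientation E D \<and> (\<forall>x. outdeg D x \<le> p x \<and> outdeg (D\<inverse>) x \<le> q x)"
proof -
  obtain D where D: "orientation E D"
    and least: "\<And>D'. orientation E D' \<Longrightarrow> excess p q E D \<le> excess p q E D'"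
    using ex_has_least_nat[of "orientation E", OF assms(1)] by metis
  have "outdeg D v \<le> p v" for v
  proof (rule ccontr)
    assume "\<not> ?thesis"
    then have "\<exists>D'. orientation E D' \<and> excess p q E D' < excess p q E D"
      by (intro excess_decrease[where v = v, OF D fin deg p]) auto
    then show False using least by (meson not_less)
  qed
  moreover have "outdeg (D\<inverse>) v \<le> q v" for v
  proof (rule ccontr)
    assume "\<not> ?thesis"
    then have "\<exists>D'. orientation E D' \<and> excess q p E D' < excess q p E (D\<inverse>)"
      using deg by (intro excess_decrease[where v = v, OF orientation_converse[OF D] fin _ q])
        (auto simp: add.commute)
    then obtain D' where "orientation E (D'\<inverse>)" "excess p q E (D'\<inverse>) < excess p q E D"
      using excess_converse[of p q E] excess_converse[of q p E] orientation_converse by metis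
    then show False using least by (meson not_less)
  qed
  ultimately show ?thesis using D by blast
qed

section \<open>Splitting a graph into two graphs of bounded even degree\<close>

lemma balanced_orientation:
  assumes "orientation E D\<^sub>0" and fin: "finite E" and deg: "\<And>x. outdeg E x \<le> 2 * k"
  shows "\<exists>D. orientation E D \<and> (\<forall>x. outdeg D x \<le> k \<and> outdeg (D\<inverse>) x \<le> k)"
proof (rule orientation_with_degree_bounds[OF assms(1) fin])
  show "outdeg E x \<le> k + k" for x using deg[of x] by simp
  show "card (E \<inter> X \<times> X) \<le> 2 * (\<Sum>x\<in>X. k)" if X: "finite X" for X
  proof -
    have "card (E \<inter> X \<times> X) = (\<Sum>x\<in>X. outdeg (E \<inter> X \<times> X) x)"
      using fin X by (intro sum_outdeg[symmetric]) auto
    also have "\<dots> \<le> (\<Sum>x\<in>X. 2 * k)"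
      by (intro sum_mono order_trans[OF outdeg_mono deg]) (use fin in auto)
    finally show ?thesis by (simp add: mult.left_commute)
  qed
  then show "card (E \<inter> X \<times> X) \<le> 2 * (\<Sum>x\<in>X. k)" if X: "finite X" for X using X .
qed

text \<open>
  The arcs of \<open>D\<close> are viewed as edges of the bipartite graph with left vertices \<open>(x, False)\<close> and
  right vertices \<open>(y, True)\<close>. An orientation of it encodes a choice of \<open>R\<close>: arcs in \<open>R\<close> point to
  the right, the others to the left.
\<close>

lemma bipartite_split:
  fixes D :: "('a \<times> 'a) set"
  assumes fin: "finite D"
    and out: "\<And>x. outdeg D x \<le> a + b" and inn: "\<And>x. outdeg (D\<inverse>) x \<le> a + b"
  shows "\<exists>R\<subseteq>D. \<forall>x. outdeg R x \<le> a \<and> outdeg (R\<inverse>) x \<le> a \<and>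
    outdeg (D - R) x \<le> b \<and> outdeg ((D - R)\<inverse>) x \<le> b"
proof -
  define lift :: "('a \<times> 'a) set \<Rightarrow> (('a \<times> bool) \<times> ('a \<times> bool)) set" where
    "lift A = (\<lambda>(x, y). ((x, False), (y, True))) ` A" for A
  have mem: "((x, i), (y, j)) \<in> lift A \<longleftrightarrow> \<not> i \<and> j \<and> (x, y) \<in> A" for x y i j A
    by (auto simp: lift_def)
  have out_lift: "outdeg (lift A) (x, i) = (if i then 0 else outdeg A x)" for A x i
  proof -
    have "lift A `` {(x, i)} = (if i then {} else (\<lambda>y. (y, True)) ` (A `` {x}))"
      by (auto simp: mem)
    then show ?thesis by (simp add: outdeg_def card_image inj_on_def)
  qed
  have in_lift: "outdeg ((lift A)\<inverse>) (x, i) = (if i then outdeg (A\<inverse>) x else 0)" for A x i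
  proof -
    have "(lift A)\<inverse> `` {(x, i)} = (if i then (\<lambda>y. (y, False)) ` (A\<inverse> `` {x}) else {})"
      by (auto simp: mem)
    then show ?thesis by (simp add: outdeg_def card_image inj_on_def)
  qed
  have finl: "finite (lift A)" if "A \<subseteq> D" for A
    unfolding lift_def using finite_subset[OF that fin] by simp
  define E where "E = lift D \<union> (lift D)\<inverse>"
  have or: "orientation E (lift D)"
    by (auto simp: orientation_def E_def lift_def)
  have finE: "finite E" using finl by (simp add: E_def)
  define p q where "p = (\<lambda>(x::'a, i). if i then b else a)" and "q = (\<lambda>(x::'a, i). if i then a else b)"
  have sparse: "card (E \<inter> X \<times> X) \<le> 2 * (\<Sum>x\<in>X. p x) \<and> card (E \<inter> X \<times> X) \<le> 2 * (\<Sum>x\<in>X. q x)"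
    if X: "finite X" for X
  proof -
    define S T where "S = X \<inter> range (\<lambda>x. (x, False))" and "T = X \<inter> range (\<lambda>x. (x, True))"
    have XST: "X = S \<union> T" "S \<inter> T = {}" "finite S" "finite T"
      using X by (auto simp: S_def T_def)
    have "(\<Sum>x\<in>X. f x) = (\<Sum>x\<in>S. f x) + (\<Sum>x\<in>T. f x)" for f :: "'a \<times> bool \<Rightarrow> nat"
      using XST by (simp add: sum.union_disjoint)
    moreover have "(\<Sum>x\<in>S. p x) = (\<Sum>x\<in>S. a)" "(\<Sum>x\<in>T. p x) = (\<Sum>x\<in>T. b)"
      "(\<Sum>x\<in>S. q x) = (\<Sum>x\<in>S. b)" "(\<Sum>x\<in>T. q x) = (\<Sum>x\<in>T. a)"
      by (rule sum.cong; auto simp: p_def q_def S_def T_def)+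
    ultimately have pq: "(\<Sum>x\<in>X. p x) = a * card S + b * card T"
      "(\<Sum>x\<in>X. q x) = b * card S + a * card T" by (simp_all add: mult.commute)
    let ?L = "lift D \<inter> X \<times> X"
    have finL: "finite ?L" using finl[of D] by simp
    have "card ?L = (\<Sum>x\<in>S. outdeg ?L x)"
      using finL XST(3) by (intro sum_outdeg[symmetric]) (auto simp: S_def mem)
    also have "\<dots> \<le> (\<Sum>x\<in>S. a + b)"
    proof (rule sum_mono)
      fix x
      have "outdeg ?L x \<le> outdeg (lift D) x" using finl[of D] by (intro outdeg_mono) auto
      also have "\<dots> \<le> a + b" using out by (cases x) (auto simp: out_lift)
      finally show "outdeg ?L x \<le> a + b" .
    qed
    finally have 1: "card ?L \<le> (a + b) * card S" by (simp add: mult.commute)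
    have "card ?L = card (?L\<inverse>)" by simp
    also have "card (?L\<inverse>) = (\<Sum>x\<in>T. outdeg (?L\<inverse>) x)"
      using finL XST(4) by (intro sum_outdeg[symmetric]) (auto simp: T_def mem)
    also have "\<dots> \<le> (\<Sum>x\<in>T. a + b)"
    proof (rule sum_mono)
      fix x
      have "outdeg (?L\<inverse>) x \<le> outdeg ((lift D)\<inverse>) x" using finl[of D] by (intro outdeg_mono) auto
      also have "\<dots> \<le> a + b" using inn by (cases x) (auto simp: in_lift)
      finally show "outdeg (?L\<inverse>) x \<le> a + b" .
    qed
    finally have 2: "card ?L \<le> (a + b) * card T" by (simp add: mult.commute)
    \<comment> \<open>The number of edges is at most \<open>a + b\<close> times the smaller of the two sides.\<close>
    have "card ?L \<le> a * card S + b * card T \<and> card ?L \<le> b * card S + a * card T"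
    proof (cases "card S \<le> card T")
      case True
      then have "a * card S \<le> a * card T" "b * card S \<le> b * card T" by simp_all
      then show ?thesis using 1 unfolding add_mult_distrib by linarith
    next
      case False
      then have "a * card T \<le> a * card S" "b * card T \<le> b * card S" by simp_all
      then show ?thesis using 2 unfolding add_mult_distrib by linarith
    qed
    then show ?thesis
      using card_orientation_restrict[OF or finE, of X] pq by simp
  qed
  have deg: "outdeg E x \<le> p x + q x" for x
    using out inn unfolding outdeg_orientation[OF or finE] p_def q_def
    by (cases x) (auto simp: out_lift in_lift add.commute)
  obtain D' where D': "orientation E D'" "\<And>x. outdeg D' x \<le> p x" "\<And>x. outdeg (D'\<inverse>) x \<le> q x"
    using orientation_with_degree_bounds[OF or finE deg] sparse by blast
  have finD': "finite D'" using orientation_finite[OF D'(1) finE] .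
  define R where "R = {(x, y) \<in> D. ((x, False), (y, True)) \<in> D'}"
  have "lift R \<subseteq> D'" by (auto simp: lift_def R_def)
  have "(lift (D - R))\<inverse> \<subseteq> D'"
  proof clarify
    fix x i y j assume "((x, i), (y, j)) \<in> lift (D - R)"
    then have *: "\<not> i" "j" "(x, y) \<in> D" "((x, i), (y, j)) \<notin> D'"
      by (auto simp: mem R_def)
    then have "((x, i), (y, j)) \<in> E" by (auto simp: E_def mem)
    then show "((y, j), (x, i)) \<in> D'" using * D'(1) by (auto simp: orientation_def)
  qed
  have red: "outdeg (lift R) z \<le> p z" "outdeg ((lift R)\<inverse>) z \<le> q z" for z
    using \<open>lift R \<subseteq> D'\<close> finD'
    by (auto intro!: order_trans[OF outdeg_mono D'(2)] order_trans[OF outdeg_mono D'(3)])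
  have blue: "outdeg (lift (D - R)) z \<le> q z" "outdeg ((lift (D - R))\<inverse>) z \<le> p z" for z
    using \<open>(lift (D - R))\<inverse> \<subseteq> D'\<close> finD'
    by (auto intro!: order_trans[OF outdeg_mono D'(2)] order_trans[OF outdeg_mono D'(3)])
  have "outdeg R x \<le> a \<and> outdeg (R\<inverse>) x \<le> a \<and> outdeg (D - R) x \<le> b \<and> outdeg ((D - R)\<inverse>) x \<le> b" for x
    using red(1)[of "(x, False)"] red(2)[of "(x, True)"] blue(1)[of "(x, False)"]
      blue(2)[of "(x, True)"]
    by (simp add: out_lift in_lift p_def q_def)
  moreover have "R \<subseteq> D" by (auto simp: R_def)
  ultimately show ?thesis by blast
qed

text \<open>
  The part \<open>R\<close> is symmetric, so \<open>R\<close> and \<open>E - R\<close> are undirected graphs again.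
\<close>

theorem even_degree_split:
  assumes "orientation E D\<^sub>0" and fin: "finite E"
    and deg: "\<And>x. outdeg E x \<le> 2 * a + 2 * b"
  shows "\<exists>R\<subseteq>E. sym R \<and> (\<forall>x. outdeg R x \<le> 2 * a \<and> outdeg (E - R) x \<le> 2 * b)"
proof -
  have "outdeg E x \<le> 2 * (a + b)" for x
    using deg[of x] by simp
  then obtain D where D: "orientation E D"
    and bal: "\<And>x. outdeg D x \<le> a + b" "\<And>x. outdeg (D\<inverse>) x \<le> a + b"
    using balanced_orientation[OF assms(1) fin] by blast
  have finD: "finite D" using orientation_finite[OF D fin] .
  obtain R where R: "R \<subseteq> D"
    and Ra: "\<And>x. outdeg R x \<le> a" "\<And>x. outdeg (R\<inverse>) x \<le> a"
    and Rb: "\<And>x. outdeg (D - R) x \<le> b" "\<And>x. outdeg ((D - R)\<inverse>) x \<le> b"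
    using bipartite_split[OF finD bal] by blast
  have dis: "D \<inter> D\<inverse> = {}" and un: "E = D \<union> D\<inverse>" using D by (auto simp: orientation_def)
  have finR: "finite R" using R finD by (rule finite_subset)
  have "outdeg (R \<union> R\<inverse>) x = outdeg R x + outdeg (R\<inverse>) x" for x
    using R dis finR by (intro outdeg_Un_disjoint) auto
  moreover have "E - (R \<union> R\<inverse>) = (D - R) \<union> (D - R)\<inverse>"
    using R dis un by auto
  moreover have "outdeg ((D - R) \<union> (D - R)\<inverse>) x = outdeg (D - R) x + outdeg ((D - R)\<inverse>) x" for x
    using dis finD by (intro outdeg_Un_disjoint) auto
  ultimately have "outdeg (R \<union> R\<inverse>) x \<le> 2 * a \<and> outdeg (E - (R \<union> R\<inverse>)) x \<le> 2 * b" for x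
    using Ra[of x] Rb[of x] by simp
  moreover have "R \<union> R\<inverse> \<subseteq> E" "sym (R \<union> R\<inverse>)"
    using R un by (auto simp: sym_def)
  ultimately show ?thesis by blast
qed


section \<open>Edges of graphs that arrow two star forests\<close>

text \<open>
  If every vertex outside \<open>W\<close> has fewer than \<open>n i\<close> neighbours outside \<open>W\<close>, then each of the first
  \<open>i\<close> stars of a copy, having at least \<open>n i\<close> leaves, meets \<open>W\<close>. The stars are disjoint, so this is
  impossible when \<open>W\<close> has fewer than \<open>i\<close> vertices.
\<close>

lemma no_star_forest_if_small_degrees:
  fixes H :: "'a graph" and n :: "nat \<Rightarrow> nat"
  assumes W: "finite W" "card W < i" and i: "i \<le> s"
    and mono: "\<And>i'. 1 \<le> i' \<Longrightarrow> i' \<le> i \<Longrightarrow> n i \<le> n i'"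
    and fin: "finite (verts H)" "\<And>e. e \<in> edges H \<Longrightarrow> e \<subseteq> verts H"
    and deg: "\<And>z. z \<notin> W \<Longrightarrow> card {y. {z, y} \<in> edges H \<and> y \<notin> W} < n i"
  shows "\<not> contains_copy H (disjoint_union {1..s} (\<lambda>i. star (n i)))"
proof
  assume "contains_copy H (disjoint_union {1..s} (\<lambda>i. star (n i)))"
  then obtain f where inj: "inj_on f (SIGMA i:{1..s}. {0..n i})"
    and edge: "\<And>i' k. i' \<in> {1..s} \<Longrightarrow> k \<in> {1..n i'} \<Longrightarrow> {f (i', 0), f (i', k)} \<in> edges H"
  proof -
    assume that: "\<And>f. inj_on f (SIGMA i:{1..s}. {0..n i}) \<Longrightarrow>
      (\<And>i' k. i' \<in> {1..s} \<Longrightarrow> k \<in> {1..n i'} \<Longrightarrow> {f (i', 0), f (i', k)} \<in> edges H) \<Longrightarrow> thesis"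
    obtain f where f: "inj_on f (verts (disjoint_union {1..s} (\<lambda>i. star (n i))))"
      "\<And>e. e \<in> edges (disjoint_union {1..s} (\<lambda>i. star (n i))) \<Longrightarrow> f ` e \<in> edges H"
      using \<open>contains_copy H _\<close> unfolding contains_copy_def by blast
    have "{f (i', 0), f (i', k)} \<in> edges H" if "i' \<in> {1..s}" "k \<in> {1..n i'}" for i' k
    proof -
      have "Pair i' ` {0, k} \<in> edges (disjoint_union {1..s} (\<lambda>i. star (n i)))"
        using that unfolding disjoint_union_def star_def graph.simps by blast
      then show ?thesis using f(2) by force
    qed
    moreover have "inj_on f (SIGMA i:{1..s}. {0..n i})"
      using f(1) by (simp add: disjoint_union_def star_def)
    ultimately show thesis using that by blast
  qed
  have touch: "\<exists>k\<in>{0..n i'}. f (i', k) \<in> W" if i': "i' \<in> {1..i}" for i'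
  proof (rule ccontr)
    assume no: "\<not> ?thesis"
    have i's: "i' \<in> {1..s}" using i' i by auto
    let ?Y = "{y. {f (i', 0), y} \<in> edges H \<and> y \<notin> W}"
    have "(\<lambda>k. f (i', k)) ` {1..n i'} \<subseteq> ?Y"
      using edge[OF i's] no by auto
    moreover have "finite ?Y"
      by (rule finite_subset[OF _ fin(1)]) (use fin(2) in auto)
    ultimately have "card ((\<lambda>k. f (i', k)) ` {1..n i'}) \<le> card ?Y"
      by (intro card_mono)
    moreover have "inj_on (\<lambda>k. f (i', k)) {1..n i'}"
    proof (rule inj_onI)
      fix x y assume xy: "x \<in> {1..n i'}" "y \<in> {1..n i'}" "f (i', x) = f (i', y)"
      then have "(i', x) = (i', y)" using i's by (intro inj_onD[OF inj xy(3)]) auto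
      then show "x = y" by simp
    qed
    ultimately have "n i' \<le> card ?Y" by (simp add: card_image)
    moreover have "card ?Y < n i" using no by (intro deg) auto
    ultimately show False using mono[of i'] i' by auto
  qed
  then obtain g where g: "\<And>i'. i' \<in> {1..i} \<Longrightarrow> g i' \<in> {0..n i'} \<and> f (i', g i') \<in> W"
    by metis
  have "inj_on (\<lambda>i'. f (i', g i')) {1..i}"
  proof (rule inj_onI)
    fix x y assume xy: "x \<in> {1..i}" "y \<in> {1..i}" "f (x, g x) = f (y, g y)"
    have "(x, g x) \<in> (SIGMA i:{1..s}. {0..n i})" "(y, g y) \<in> (SIGMA i:{1..s}. {0..n i})"
      using xy g i by auto
    then show "x = y" using inj_onD[OF inj xy(3)] by simp
  qed
  then have "card {1..i} \<le> card W"
    using g W(1) by (intro card_inj_on_le[of "\<lambda>i'. f (i', g i')"]) auto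
  then show False using W(2) by simp
qed

text \<open>
  The linear order on the vertices serves only to provide some initial orientation of the graph.
\<close>

lemma arrows_imp_large_degree:
  fixes G :: "'a::linorder graph" and n m :: "nat \<Rightarrow> nat"
  assumes G: "simple_graph G"
    and arr: "arrows G (disjoint_union {1..s} (\<lambda>i. star (n i))) (disjoint_union {1..t} (\<lambda>j. star (m j)))"
    and i: "1 \<le> i" "i \<le> s" and j: "1 \<le> j" "j \<le> t"
    and n: "\<And>i'. 1 \<le> i' \<Longrightarrow> i' \<le> i \<Longrightarrow> n i \<le> n i'" "odd (n i)"
    and m: "\<And>j'. 1 \<le> j' \<Longrightarrow> j' \<le> j \<Longrightarrow> m j \<le> m j'" "odd (m j)"
    and W: "finite W" "card W \<le> i + j - 2"
  shows "\<exists>v. v \<notin> W \<and> n i + m j - 1 \<le> card {y. {v, y} \<in> edges G \<and> y \<notin> W}"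
proof (rule ccontr)
  assume "\<not> ?thesis"
  then have small: "card {y. {v, y} \<in> edges G \<and> y \<notin> W} < n i + m j - 1" if "v \<notin> W" for v
    using that by (auto simp: not_le)
  obtain a where a: "n i = 2 * a + 1" using n(2) by (elim oddE)
  obtain b where b: "m j = 2 * b + 1" using m(2) by (elim oddE)
  have finV: "finite (verts G)" and eV: "\<And>e. e \<in> edges G \<Longrightarrow> e \<subseteq> verts G"
    and e2: "\<And>e. e \<in> edges G \<Longrightarrow> card e = 2"
    using G by (auto simp: simple_graph_def)
  define E where "E = {(x, y). {x, y} \<in> edges G \<and> x \<notin> W \<and> y \<notin> W}"
  have "E \<subseteq> verts G \<times> verts G" using eV by (force simp: E_def)
  then have finE: "finite E" using finV by (meson finite_SigmaI finite_subset)
  have "x \<noteq> y" if "(x, y) \<in> E" for x y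
    using that e2 by (force simp: E_def)
  then have orE: "orientation E {(x, y) \<in> E. x < y}"
    by (auto simp: orientation_def E_def insert_commute neq_iff)
  have degE: "outdeg E x \<le> 2 * a + 2 * b" for x
  proof (cases "x \<in> W")
    case True
    then have "E `` {x} = {}" by (auto simp: E_def)
    then show ?thesis by (simp add: outdeg_def)
  next
    case False
    then have "E `` {x} = {y. {x, y} \<in> edges G \<and> y \<notin> W}" by (auto simp: E_def)
    then show ?thesis using small[OF False] a b by (simp add: outdeg_def)
  qed
  obtain R where R: "R \<subseteq> E" "sym R"
    and deg: "\<And>x. outdeg R x \<le> 2 * a" "\<And>x. outdeg (E - R) x \<le> 2 * b"
    using even_degree_split[OF orE finE degE] by blast
  obtain A B where AB: "W = A \<union> B" "card A < i" "card B < j"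
  proof (cases "card W < i")
    case True
    then show thesis using that[of W "{}"] j by simp
  next
    case False
    then obtain A where A: "A \<subseteq> W" "card A = i - 1"
      by (meson obtain_subset_with_card_n diff_le_self le_trans not_le)
    then have "card (W - A) < j"
      using W i j finite_subset[OF A(1) W(1)] by (simp add: card_Diff_subset)
    then show thesis using that[of A "W - A"] A i by auto
  qed
  have finAB: "finite A" "finite B" using AB(1) W(1) by auto
  \<comment> \<open>Edges between \<open>A\<close> and \<open>B\<close> are red; this is harmless, since they meet both sets.\<close>
  define c where "c e = (if e \<inter> A \<noteq> {} then Red else if e \<inter> B \<noteq> {} then Blue
    else if \<exists>(x, y) \<in> R. e = {x, y} then Red else Blue)" for e
  have R_iff: "(\<exists>(x, y) \<in> R. {z, w} = {x, y}) \<longleftrightarrow> (z, w) \<in> R" for z w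
    using R(2) by (auto simp: doubleton_eq_iff dest: symD)
  have red: "(z, y) \<in> R" if "c {z, y} = Red" "z \<notin> A" "y \<notin> A" for z y
    using that unfolding c_def R_iff by (auto split: if_splits)
  have blue: "(z, y) \<in> E - R" if "{z, y} \<in> edges G" "c {z, y} = Blue" "z \<notin> B" "y \<notin> B" for z y
    using that unfolding c_def R_iff by (auto simp: E_def AB(1) split: if_splits)
  have "\<not> contains_copy (colour_subgraph G c Red) (disjoint_union {1..s} (\<lambda>i. star (n i)))"
  proof (rule no_star_forest_if_small_degrees[where n = n and i = i and W = A])
    fix z assume z: "z \<notin> A"
    have "{y. {z, y} \<in> edges (colour_subgraph G c Red) \<and> y \<notin> A} \<subseteq> R `` {z}"
      using red z by (auto simp: colour_subgraph_def)
    moreover have "finite (R `` {z})" using finite_subset[OF R(1) finE] by (rule finite_Image)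
    ultimately have "card {y. {z, y} \<in> edges (colour_subgraph G c Red) \<and> y \<notin> A} \<le> outdeg R z"
      unfolding outdeg_def by (intro card_mono)
    also have "\<dots> < n i" using deg(1)[of z] a by simp
    finally show "card {y. {z, y} \<in> edges (colour_subgraph G c Red) \<and> y \<notin> A} < n i" .
  qed (use AB finAB i n(1) finV eV in \<open>auto simp: colour_subgraph_def\<close>)
  moreover have "\<not> contains_copy (colour_subgraph G c Blue) (disjoint_union {1..t} (\<lambda>j. star (m j)))"
  proof (rule no_star_forest_if_small_degrees[where n = m and i = j and W = B])
    fix z assume z: "z \<notin> B"
    have "{y. {z, y} \<in> edges (colour_subgraph G c Blue) \<and> y \<notin> B} \<subseteq> (E - R) `` {z}"
      using blue z by (auto simp: colour_subgraph_def)
    moreover have "finite ((E - R) `` {z})" using finE by (auto intro: finite_Image)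
    ultimately have "card {y. {z, y} \<in> edges (colour_subgraph G c Blue) \<and> y \<notin> B} \<le> outdeg (E - R) z"
      unfolding outdeg_def by (intro card_mono)
    also have "\<dots> < m j" using deg(2)[of z] b by simp
    finally show "card {y. {z, y} \<in> edges (colour_subgraph G c Blue) \<and> y \<notin> B} < m j" .
  qed (use AB finAB j m(1) finV eV in \<open>auto simp: colour_subgraph_def\<close>)
  ultimately show False using arr by (auto simp: arrows_def)
qed

text \<open>
  In a graph that keeps a vertex of degree at least \<open>d k\<close> after the deletion of any \<open>k\<close> vertices,
  such vertices are deleted one after another; \<open>W\<close> is the set deleted so far, and the at least
  \<open>d k\<close> edges counted at the next vertex avoid it.
\<close>

lemma sum_le_card_edges:
  fixes d :: "nat \<Rightarrow> nat"
  assumes fin: "finite (edges G)"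
    and large: "\<And>k W. k < r \<Longrightarrow> finite W \<Longrightarrow> card W \<le> k \<Longrightarrow>
      \<exists>v. v \<notin> W \<and> d k \<le> card {y. {v, y} \<in> edges G \<and> y \<notin> W}"
  shows "(\<Sum>k<r. d k) \<le> card (edges G)"
proof -
  have "\<exists>W. finite W \<and> card W \<le> k \<and> (\<Sum>j<k. d j) \<le> card {e \<in> edges G. e \<inter> W \<noteq> {}}"
    if "k \<le> r" for k
    using that
  proof (induction k)
    case 0
    then show ?case by (intro exI[of _ "{}"]) simp
  next
    case (Suc k)
    then obtain W where W: "finite W" "card W \<le> k" "(\<Sum>j<k. d j) \<le> card {e \<in> edges G. e \<inter> W \<noteq> {}}"
      by auto
    obtain v where v: "v \<notin> W" "d k \<le> card {y. {v, y} \<in> edges G \<and> y \<notin> W}"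
      using large[of k W] W Suc.prems by auto
    let ?T = "{e \<in> edges G. e \<inter> W \<noteq> {}}" and ?Y = "{y. {v, y} \<in> edges G \<and> y \<notin> W}"
    have new: "?T \<inter> (\<lambda>y. {v, y}) ` ?Y = {}" using v(1) by auto
    have sub: "?T \<union> (\<lambda>y. {v, y}) ` ?Y \<subseteq> {e \<in> edges G. e \<inter> insert v W \<noteq> {}}" by auto
    have inj: "inj_on (\<lambda>y. {v, y}) ?Y" by (auto simp: inj_on_def doubleton_eq_iff)
    have finY: "finite ((\<lambda>y. {v, y}) ` ?Y)" by (rule finite_subset[OF _ fin]) auto
    have "(\<Sum>j<Suc k. d j) \<le> card ?T + card ((\<lambda>y. {v, y}) ` ?Y)"
      using W(3) v(2) by (simp add: card_image[OF inj])
    also have "\<dots> = card (?T \<union> (\<lambda>y. {v, y}) ` ?Y)"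
      using fin finY new by (intro card_Un_disjoint[symmetric]) auto
    also have "\<dots> \<le> card {e \<in> edges G. e \<inter> insert v W \<noteq> {}}"
      using fin sub by (intro card_mono) auto
    finally have "(\<Sum>j<Suc k. d j) \<le> card {e \<in> edges G. e \<inter> insert v W \<noteq> {}}" .
    moreover have "card (insert v W) \<le> Suc k" using W v(1) by simp
    ultimately show ?case using W(1) by blast
  qed
  from this[of r] obtain W where "(\<Sum>k<r. d k) \<le> card {e \<in> edges G. e \<inter> W \<noteq> {}}"
    by auto
  also have "\<dots> \<le> card (edges G)" using fin by (intro card_mono) auto
  finally show ?thesis .
qed

section \<open>A star forest that arrows two star forests\<close>

text \<open>
  Greedy systems of distinct representatives: when \<open>g i\<close> is chosen, only \<open>i - 1\<close> elements are taken.
  Infinite sets have cardinality \<open>0\<close> and so do not satisfy the assumption.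
\<close>

lemma injective_choice:
  assumes "\<And>i. 1 \<le> i \<Longrightarrow> i \<le> s \<Longrightarrow> i \<le> card (S i)"
  shows "\<exists>g. inj_on g {1..s::nat} \<and> (\<forall>i\<in>{1..s}. g i \<in> S i)"
  using assms
proof (induction s)
  case 0
  then show ?case by simp
next
  case (Suc s)
  then obtain g where g: "inj_on g {1..s}" "\<And>i. i \<in> {1..s} \<Longrightarrow> g i \<in> S i" by force
  have "card (g ` {1..s}) < card (S (Suc s))"
    using Suc.prems[of "Suc s"] card_image[OF g(1)] by simp
  then have "\<not> S (Suc s) \<subseteq> g ` {1..s}"
    using card_mono[of "g ` {1..s}" "S (Suc s)"] by auto
  then obtain x where x: "x \<in> S (Suc s)" "x \<notin> g ` {1..s}" by blast
  have "inj_on (g(Suc s := x)) {1..s}"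
    using inj_on_fun_updI[OF g(1) x(2)] .
  moreover have "(g(Suc s := x)) ` {1..s} = g ` {1..s}"
    by (intro image_cong) auto
  ultimately have "inj_on (g(Suc s := x)) (insert (Suc s) {1..s})"
    using x(2) by simp
  then have "inj_on (g(Suc s := x)) {1..Suc s}"
    by (simp add: atLeastAtMostSuc_conv)
  moreover have "\<forall>i\<in>{1..Suc s}. (g(Suc s := x)) i \<in> S i"
    using g(2) x(1) by (auto simp: atLeastAtMostSuc_conv)
  ultimately show ?case by blast
qed

text \<open>
  \<open>card {x \<in> {1..l k}. c {(k, 0), (k, x)} = r}\<close> is the number of edges of colour \<open>r\<close> in the \<open>k\<close>-th
  star of the host. If at least \<open>i\<close> stars have at least \<open>n i\<close> edges of colour \<open>r\<close>, for every \<open>i\<close>, then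
  distinct host stars can be assigned to the stars of the forest.
\<close>

lemma contains_star_forest:
  fixes c :: "(nat \<times> nat) set \<Rightarrow> colour"
  assumes many: "\<And>i. 1 \<le> i \<Longrightarrow> i \<le> s \<Longrightarrow>
    i \<le> card {k \<in> K. n i \<le> card {x \<in> {1..l k}. c {(k, 0), (k, x)} = r}}"
  shows "contains_copy (colour_subgraph (disjoint_union K (\<lambda>k. star (l k))) c r)
    (disjoint_union {1..s} (\<lambda>i. star (n i)))"
proof -
  define L where "L k = {x \<in> {1..l k}. c {(k, 0), (k, x)} = r}" for k
  obtain g where g: "inj_on g {1..s}" "\<And>i. i \<in> {1..s} \<Longrightarrow> g i \<in> K \<and> n i \<le> card (L (g i))"
    using injective_choice[of s "\<lambda>i. {k \<in> K. n i \<le> card (L k)}"] many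
    by (auto simp: L_def)
  have "\<exists>h. h ` {1..n i} \<subseteq> L (g i) \<and> inj_on h {1..n i}" if "i \<in> {1..s}" for i
    using g(2)[OF that] by (intro card_le_inj) (auto simp: L_def)
  then obtain h where h: "\<And>i. i \<in> {1..s} \<Longrightarrow> inj_on (h i) {1..n i} \<and> h i ` {1..n i} \<subseteq> L (g i)"
    by metis
  define f where "f = (\<lambda>(i, x). (g i, if x = 0 then 0 else h i x))"
  have leaf: "h i x \<in> L (g i)" if "i \<in> {1..s}" "x \<in> {1..n i}" for i x
    using h[OF that(1)] that(2) by blast
  have L: "x \<noteq> 0" "x \<le> l k" "c {(k, 0), (k, x)} = r" if "x \<in> L k" for k x
    using that by (auto simp: L_def)
  have "inj_on f (SIGMA i:{1..s}. {0..n i})"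
  proof (rule inj_onI, clarify)
    fix i x i' x'
    assume i: "i \<in> {1..s}" "x \<in> {0..n i}" and i': "i' \<in> {1..s}" "x' \<in> {0..n i'}"
      and eq: "f (i, x) = f (i', x')"
    have ii: "i' = i" using eq inj_onD[OF g(1) _ i(1) i'(1)] by (auto simp: f_def)
    have "x = x'"
    proof (cases "x = 0 \<or> x' = 0")
      case True
      then show ?thesis
        using eq ii L(1)[OF leaf[of i x]] L(1)[OF leaf[of i x']] i i'
        by (auto simp: f_def split: if_splits)
    next
      case False
      then have "x \<in> {1..n i}" "x' \<in> {1..n i}" using i i' ii by auto
      moreover have "h i x = h i x'" using eq ii False by (simp add: f_def)
      ultimately show ?thesis using inj_onD[OF conjunct1[OF h[OF i(1)]]] by blast
    qed
    then show "i = i' \<and> x = x'" using ii by simp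
  qed
  moreover have "f ` (SIGMA i:{1..s}. {0..n i}) \<subseteq> (SIGMA k:K. {0..l k})"
    using g(2) L(2)[OF leaf] by (auto simp: f_def)
  moreover have "f ` Pair i ` {0, x} \<in> {e \<in> edges (disjoint_union K (\<lambda>k. star (l k))). c e = r}"
    if i: "i \<in> {1..s}" and x: "x \<in> {1..n i}" for i x
  proof -
    have "f ` Pair i ` {0, x} = Pair (g i) ` {0, h i x}" using x by (auto simp: f_def)
    moreover have "Pair (g i) ` {0, h i x} \<in> edges (disjoint_union K (\<lambda>k. star (l k)))"
      using g(2)[OF i] leaf[OF i x]
      unfolding disjoint_union_def star_def graph.simps L_def by blast
    moreover have "c (Pair (g i) ` {0, h i x}) = r" using L(3)[OF leaf[OF i x]] by simp
    ultimately show ?thesis by simp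
  qed
  ultimately show ?thesis
    unfolding contains_copy_def
    by (intro exI[of _ f]) (auto simp: disjoint_union_def star_def colour_subgraph_def)
qed

lemma star_forest_arrows:
  fixes n m l :: "nat \<Rightarrow> nat"
  assumes l: "\<And>i j k. 1 \<le> i \<Longrightarrow> i \<le> s \<Longrightarrow> 1 \<le> j \<Longrightarrow> j \<le> t \<Longrightarrow> 2 \<le> k \<Longrightarrow> k \<le> i + j \<Longrightarrow>
      n i + m j - 1 \<le> l k"
  shows "arrows (disjoint_union {2..s + t} (\<lambda>k. star (l k)))
    (disjoint_union {1..s} (\<lambda>i. star (n i))) (disjoint_union {1..t} (\<lambda>j. star (m j)))"
  unfolding arrows_def
proof (intro allI, rule ccontr)
  fix c :: "(nat \<times> nat) set \<Rightarrow> colour"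
  let ?G = "disjoint_union {2..s + t} (\<lambda>k. star (l k))"
  let ?d = "\<lambda>r k. card {x \<in> {1..l k}. c {(k, 0), (k, x)} = r}"
  assume no: "\<not> (contains_copy (colour_subgraph ?G c Red) (disjoint_union {1..s} (\<lambda>i. star (n i))) \<or>
    contains_copy (colour_subgraph ?G c Blue) (disjoint_union {1..t} (\<lambda>j. star (m j))))"
  obtain i where i: "1 \<le> i" "i \<le> s" "card {k \<in> {2..s + t}. n i \<le> ?d Red k} < i"
    using no contains_star_forest[of s "{2..s + t}" n l c Red] by (meson not_le)
  obtain j where j: "1 \<le> j" "j \<le> t" "card {k \<in> {2..s + t}. m j \<le> ?d Blue k} < j"
    using no contains_star_forest[of t "{2..s + t}" m l c Blue] by (meson not_le)
  let ?S = "{k \<in> {2..s + t}. n i \<le> ?d Red k}" and ?T = "{k \<in> {2..s + t}. m j \<le> ?d Blue k}"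
  have "card (?S \<union> ?T) \<le> card ?S + card ?T" by (rule card_Un_le)
  also have "\<dots> < card {2..i + j}" using i j by simp
  finally have "\<not> {2..i + j} \<subseteq> ?S \<union> ?T"
    using card_mono[of "?S \<union> ?T" "{2..i + j}"] by auto
  then obtain k where k: "k \<in> {2..i + j}" "k \<notin> ?S" "k \<notin> ?T" by blast
  then have "?d Red k < n i" "?d Blue k < m j" using i j by auto
  moreover have "?d Red k + ?d Blue k = l k"
  proof -
    have cases: "c e = Red \<or> c e = Blue" for e by (cases "c e") auto
    have "?d Red k + ?d Blue k = card ({x \<in> {1..l k}. c {(k, 0), (k, x)} = Red} \<union>
        {x \<in> {1..l k}. c {(k, 0), (k, x)} = Blue})"
      by (intro card_Un_disjoint[symmetric]) auto
    also have "{x \<in> {1..l k}. c {(k, 0), (k, x)} = Red} \<union>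
        {x \<in> {1..l k}. c {(k, 0), (k, x)} = Blue} = {1..l k}"
      using cases by auto
    finally show ?thesis by simp
  qed
  moreover have "n i + m j - 1 \<le> l k" using l i j k(1) by auto
  ultimately show False by linarith
qed

lemma card_edges_star_forest:
  assumes "finite K"
  shows "card (edges (disjoint_union K (\<lambda>k. star (l k)))) = (\<Sum>k\<in>K. l k)"
proof -
  have "edges (disjoint_union K (\<lambda>k. star (l k))) =
      (\<lambda>(k, x). {(k, 0), (k, x)}) ` (SIGMA k:K. {1..l k})"
    (is "?E = ?f ` ?S")
  proof (intro equalityI subsetI)
    fix e assume "e \<in> ?E"
    then obtain k x where "k \<in> K" "x \<in> {1..l k}" "e = Pair k ` {0, x}"
      unfolding disjoint_union_def star_def graph.simps by blast
    then show "e \<in> ?f ` ?S" by (intro image_eqI[of _ _ "(k, x)"]) auto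
  next
    fix e assume "e \<in> ?f ` ?S"
    then obtain k x where "k \<in> K" "x \<in> {1..l k}" "e = Pair k ` {0, x}" by auto
    then show "e \<in> ?E" unfolding disjoint_union_def star_def graph.simps by blast
  qed
  moreover have "inj_on (\<lambda>(k, x). {(k, 0), (k, x::nat)}) (SIGMA k:K. {1..l k})"
    by (auto simp: inj_on_def doubleton_eq_iff)
  ultimately show ?thesis using assms by (simp add: card_image)
qed

section \<open>The size Ramsey number of star forests with odd stars\<close>

theorem theorem2p5:
  fixes s t :: nat and n m :: "nat \<Rightarrow> nat" and l :: "nat \<Rightarrow> nat"
    and F1 F2 :: "(nat \<times> nat) graph"
  assumes "s \<ge> 1" and "t \<ge> 1"
    and "\<And>i j. 1 \<le> i \<Longrightarrow> i \<le> j \<Longrightarrow> j \<le> s \<Longrightarrow> n i \<ge> n j"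
    and "\<And>i j. 1 \<le> i \<Longrightarrow> i \<le> j \<Longrightarrow> j \<le> t \<Longrightarrow> m i \<ge> m j"
    and "\<And>i. 1 \<le> i \<Longrightarrow> i \<le> s \<Longrightarrow> n i > 0 \<and> odd (n i)"
    and "\<And>j. 1 \<le> j \<Longrightarrow> j \<le> t \<Longrightarrow> m j > 0 \<and> odd (m j)"
    and "F1 = disjoint_union {1..s} (\<lambda>i. star (n i))"
    and "F2 = disjoint_union {1..t} (\<lambda>j. star (m j))"
    and "\<And>k. 2 \<le> k \<Longrightarrow> k \<le> s + t \<Longrightarrow>
           l k = Max {n i + m j - 1 | i j. 1 \<le> i \<and> i \<le> s \<and> 1 \<le> j \<and> j \<le> t \<and> i + j = k}"
  shows "size_ramsey F1 F2 = (\<Sum>k = 2..s + t. l k)"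
proof -
  let ?M = "\<lambda>k. {n i + m j - 1 | i j. 1 \<le> i \<and> i \<le> s \<and> 1 \<le> j \<and> j \<le> t \<and> i + j = k}"
  have finM: "finite (?M k)" for k
    by (rule finite_subset[of _ "(\<lambda>(i, j). n i + m j - 1) ` ({1..s} \<times> {1..t})"]) auto
  \<comment> \<open>As \<open>n\<close> and \<open>m\<close> are nonincreasing, lowering \<open>i\<close> and \<open>j\<close> until their sum is \<open>k\<close> does not decrease \<open>n i + m j - 1\<close>.\<close>
  have split: "\<exists>i' j'. 1 \<le> i' \<and> i' \<le> i \<and> 1 \<le> j' \<and> j' \<le> j \<and> i' + j' = k"
    if "1 \<le> i" "1 \<le> j" "2 \<le> k" "k \<le> i + j" for i j k :: nat
    using that by (intro exI[of _ "min i (k - 1)"] exI[of _ "k - min i (k - 1)"]) auto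
  have l_ge: "n i + m j - 1 \<le> l k"
    if ij: "1 \<le> i" "i \<le> s" "1 \<le> j" "j \<le> t" and k: "2 \<le> k" "k \<le> i + j" for i j k
  proof -
    obtain i' j' where i'j': "1 \<le> i'" "i' \<le> i" "1 \<le> j'" "j' \<le> j" "i' + j' = k"
      using split[OF ij(1,3) k] by blast
    then have "n i \<le> n i'" "m j \<le> m j'" using assms(3)[of i' i] assms(4)[of j' j] ij by auto
    then have "n i + m j - 1 \<le> n i' + m j' - 1" by simp
    also have "\<dots> \<le> Max (?M k)"
    proof (rule Max_ge[OF finM])
      show "n i' + m j' - 1 \<in> ?M k" using i'j' ij le_trans by blast
    qed
    also have "\<dots> = l k" using assms(9)[of k] ij k by simp
    finally show ?thesis .
  qed
  have l_att: "\<exists>i j. 1 \<le> i \<and> i \<le> s \<and> 1 \<le> j \<and> j \<le> t \<and> i + j = k \<and> l k = n i + m j - 1"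
    if k: "2 \<le> k" "k \<le> s + t" for k
  proof -
    have "?M k \<noteq> {}" using split[OF assms(1,2) k] by blast
    then have "Max (?M k) \<in> ?M k" by (rule Max_in[OF finM])
    then show ?thesis using assms(9)[OF k] by auto
  qed
  have lower: "(\<Sum>k = 2..s + t. l k) \<le> card (edges G)"
    if G: "simple_graph G" "arrows G F1 F2" for G :: "nat graph"
  proof -
    have "edges G \<subseteq> Pow (verts G)" "finite (verts G)" using G(1) by (auto simp: simple_graph_def)
    then have fin: "finite (edges G)" by (meson finite_Pow_iff finite_subset)
    have "(\<Sum>k<s + t - 1. l (k + 2)) \<le> card (edges G)"
    proof (rule sum_le_card_edges[OF fin])
      fix k :: nat and W :: "nat set"
      assume k: "k < s + t - 1" and W: "finite W" "card W \<le> k"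
      have "2 \<le> k + 2" "k + 2 \<le> s + t" using k by simp_all
      then obtain i j where ij: "1 \<le> i" "i \<le> s" "1 \<le> j" "j \<le> t" "i + j = k + 2"
        and lk: "l (k + 2) = n i + m j - 1"
        using l_att by blast
      show "\<exists>v. v \<notin> W \<and> l (k + 2) \<le> card {y. {v, y} \<in> edges G \<and> y \<notin> W}"
        unfolding lk
      proof (rule arrows_imp_large_degree[OF G(1) _ ij(1-4)])
        show "arrows G (disjoint_union {1..s} (\<lambda>i. star (n i)))
            (disjoint_union {1..t} (\<lambda>j. star (m j)))"
          using G(2) assms(7,8) by simp
      qed (use ij W assms(3-6) in auto)
    qed
    moreover have "(\<Sum>k<s + t - 1. l (k + 2)) = (\<Sum>k = 2..s + t. l k)"
      by (rule sum.reindex_bij_witness[where i = "\<lambda>k. k - 2" and j = "\<lambda>k. k + 2"])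
        (use assms(1,2) in auto)
    ultimately show ?thesis by simp
  qed
  let ?H = "disjoint_union {2..s + t} (\<lambda>k. star (l k))"
  have "simple_graph (star (l k))" if k: "k \<in> {2..s + t}" for k
  proof (rule simple_graph_star)
    obtain i j where "1 \<le> i" "i \<le> s" "1 \<le> j" "j \<le> t" "l k = n i + m j - 1"
      using l_att k by (meson atLeastAtMost_iff)
    then show "1 \<le> l k" using assms(5)[of i] assms(6)[of j] by linarith
  qed
  then have "simple_graph ?H" by (intro simple_graph_disjoint_union) auto
  moreover have "arrows ?H F1 F2"
    unfolding assms(7,8) by (rule star_forest_arrows) (rule l_ge)
  ultimately obtain G :: "nat graph" where G: "simple_graph G" "arrows G F1 F2"
    "card (edges G) = (\<Sum>k = 2..s + t. l k)"
    using arrows_nat_host[of ?H F1 F2] card_edges_star_forest[of "{2..s + t}" l] by auto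
  show ?thesis
    unfolding size_ramsey_def
  proof (rule cInf_eq_minimum)
    show "(\<Sum>k = 2..s + t. l k) \<in>
        {card (edges G) | G :: nat graph. simple_graph G \<and> arrows G F1 F2}"
      using G by force
  qed (use lower in auto)
qed

end
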